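(* Let $\Lambda,\Gamma$ be $S$-sorted sets of formulas, $s\in S$ and $\varphi,\phi\in Form_s$. The following are equivalent: (i) $\Gamma\cup\{\varphi\}^S\vdash_{\mathbf K\Lambda}\phi$; (ii) $\Gamma\vdash_{\mathbf K\Lambda}\varphi_1\wedge\cdots\wedge\varphi_n\to\phi$ for some $\varphi_1,\ldots,\varphi_n\in(\{\varphi\}_G)_s$.
   Context: Let $(S,\Sigma)$ be a many-sorted signature (each $\sigma\in\Sigma$ has a type $s_1\ldots s_n\to s$, $n\ge0$; $\Sigma_{s_1\ldots s_n,s}$ the symbols of that type; $[n]=\{1,\ldots,n\}$), and $P=\{P_s\}_{s\in S}$ nonempty pairwise disjoint sets of propositional variables. Formulas $Form_s$: $P_s\subseteq Form_s$, closure under $\neg,\vee$ within a sort, and $\sigma(\phi_1,\ldots,\phi_n)\in Form_s$ for $\sigma\in\Sigma_{s_1\ldots s_n,s}$, $\phi_i\in Form_{s_i}$. Abbreviations: $\wedge,\to,\leftrightarrow$; for $n\ge1$, $\sigma^\Box(\phi_1,\ldots,\phi_n):=\neg\sigma(\neg\phi_1,\ldots,\neg\phi_n)$. $\mathbf K=\{\mathbf K_s\}$: the least $S$-sorted set containing in each sort all classical propositional theorems and, for $n\ge1$, $\sigma\in\Sigma_{s_1\ldots s_n,s}$, $i\in[n]$, $\psi_j\in Form_{s_j}$, $\phi,\chi\in Form_{s_i}$, the axioms $\sigma^\Box(\ldots,\phi\to\chi,\ldots)\to(\sigma^\Box(\ldots,\phi,\ldots)\to\sigma^\Box(\ldots,\chi,\ldots))$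 (position $i$, other arguments $\psi_j$) and $\sigma(\psi_1,\ldots,\psi_n)\leftrightarrow\neg\sigma^\Box(\neg\psi_1,\ldots,\neg\psi_n)$. $\mathbf K\Lambda_s$ is $\mathbf K_s$ plus all sort-preserving uniform substitution instances of formulas of $\Lambda_s$ (its elements are the axioms). Rules: modus ponens (MP) within a sort; universal generalization (UG): from $\phi\in Form_{s_i}$ infer $\sigma^\Box(\psi_1,\ldots,\psi_{i-1},\phi,\psi_{i+1},\ldots,\psi_n)$ for $\sigma\in\Sigma_{s_1\ldots s_n,s}$, $n\ge1$, $i\in[n]$, $\psi_j\in Form_{s_j}$. Global deduction: for an $S$-sorted set $\Gamma=\{\Gamma_s\}$ and $\phi\in Form_s$, $\Gamma\vdash_{\mathbf K\Lambda}\phi$ means there is a sequence $\phi_1,\ldots,\phi_m=\phi$ of formulas (of arbitrary sorts $s_i$) each of which is in $\mathbf K\Lambda_{s_i}$, or in $\Gamma_{s_i}$, or follows from earlier ones by MP or UG. For $\varphi\in Form_s$, $\{\varphi\}^S$ is the $S$-sorted set with $\{\varphi\}^S_s=\{\varphi\}$ and $\{\varphi\}^S_t=\emptyset$ for $t\ne s$. For an $S$-sorted set $\Delta$, $\Delta_G=\bigcup_k\Delta^k$ where $\Delta^0=\Delta$ and $\Delta^{k+1}_s=\Delta^k_s\cup\{\sigma^\Box(\psi_1,\ldots,\psi_{i-1},\gamma,\psi_{i+1},\ldots,\psi_n)\mid \sigma\in\Sigma_{s_1\ldots s_n,s},n\ge1, i\in[n],\gamma\in\Delta^k_{s_i},\psi_j\in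 Form_{s_j}\}$. $\{\varphi\}_G:=(\{\varphi\}^S)_G$. *)

theory Defs
  imports Main
begin

text \<open>
  The set of sorts is a type \<open>'s\<close>. A symbol \<open>\<sigma> \<in> symbols L\<close> has type
  \<open>arity L \<sigma> \<rightarrow> target L \<sigma>\<close>, and \<open>pvars L s\<close> is the set of propositional
  variables of sort \<open>s\<close>. Argument positions are counted from 0.
\<close>

record ('s, 'o, 'p) language =
  symbols :: "'o set"
  arity :: "'o \<Rightarrow> 's list"
  target :: "'o \<Rightarrow> 's"
  pvars :: "'s \<Rightarrow> 'p set"

definition is_language :: "('s, 'o, 'p) language \<Rightarrow> bool" where
  "is_language L \<longleftrightarrow>
     (\<forall>s. pvars L s \<noteq> {}) \<and> (\<forall>s t. s \<noteq> t \<longrightarrow> pvars L s \<inter> pvars L t = {})"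

datatype ('o, 'p) fm =
    Var 'p
  | Neg "('o, 'p) fm"
  | Or "('o, 'p) fm" "('o, 'p) fm"
  | App 'o "('o, 'p) fm list"

inductive has_sort :: "('s, 'o, 'p) language \<Rightarrow> ('o, 'p) fm \<Rightarrow> 's \<Rightarrow> bool" for L where
  "p \<in> pvars L s \<Longrightarrow> has_sort L (Var p) s"
| "has_sort L \<phi> s \<Longrightarrow> has_sort L (Neg \<phi>) s"
| "has_sort L \<phi> s \<Longrightarrow> has_sort L \<psi> s \<Longrightarrow> has_sort L (Or \<phi> \<psi>) s"
| "\<sigma> \<in> symbols L \<Longrightarrow> list_all2 (has_sort L) \<phi>s (arity L \<sigma>) \<Longrightarrow>
     has_sort L (App \<sigma> \<phi>s) (target L \<sigma>)"

definition Form :: "('s, 'o, 'p) language \<Rightarrow> 's \<Rightarrow> ('o, 'p) fm set" where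
  "Form L s = {\<phi>. has_sort L \<phi> s}"

definition Args :: "('s, 'o, 'p) language \<Rightarrow> 'o \<Rightarrow> ('o, 'p) fm list set" where
  "Args L \<sigma> = {\<psi>s. length \<psi>s = length (arity L \<sigma>) \<and>
     (\<forall>j < length (arity L \<sigma>). \<psi>s ! j \<in> Form L (arity L \<sigma> ! j))}"

definition And :: "('o, 'p) fm \<Rightarrow> ('o, 'p) fm \<Rightarrow> ('o, 'p) fm" where
  "And \<phi> \<psi> = Neg (Or (Neg \<phi>) (Neg \<psi>))"

definition Imp :: "('o, 'p) fm \<Rightarrow> ('o, 'p) fm \<Rightarrow> ('o, 'p) fm" where
  "Imp \<phi> \<psi> = Or (Neg \<phi>) \<psi>"

definition Iff :: "('o, 'p) fm \<Rightarrow> ('o, 'p) fm \<Rightarrow> ('o, 'p) fm" where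
  "Iff \<phi> \<psi> = And (Imp \<phi> \<psi>) (Imp \<psi> \<phi>)"

definition Box :: "'o \<Rightarrow> ('o, 'p) fm list \<Rightarrow> ('o, 'p) fm" where
  "Box \<sigma> \<phi>s = Neg (App \<sigma> (map Neg \<phi>s))"

text \<open>Left-associated conjunction of a nonempty list.\<close>

definition BigAnd :: "('o, 'p) fm list \<Rightarrow> ('o, 'p) fm" where
  "BigAnd \<phi>s = foldl And (hd \<phi>s) (tl \<phi>s)"

text \<open>
  Classical propositional theorems are the tautologies, where variables and formulas
  \<open>App \<sigma> \<phi>s\<close> count as atoms.
\<close>

fun truth :: "(('o, 'p) fm \<Rightarrow> bool) \<Rightarrow> ('o, 'p) fm \<Rightarrow> bool" where
  "truth v (Neg \<phi>) \<longleftrightarrow> \<not> truth v \<phi>"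
| "truth v (Or \<phi> \<psi>) \<longleftrightarrow> truth v \<phi> \<or> truth v \<psi>"
| "truth v (Var p) \<longleftrightarrow> v (Var p)"
| "truth v (App \<sigma> \<phi>s) \<longleftrightarrow> v (App \<sigma> \<phi>s)"

definition prop_theorem :: "('o, 'p) fm \<Rightarrow> bool" where
  "prop_theorem \<phi> \<longleftrightarrow> (\<forall>v. truth v \<phi>)"

inductive K :: "('s, 'o, 'p) language \<Rightarrow> 's \<Rightarrow> ('o, 'p) fm \<Rightarrow> bool" for L where
  K_prop: "\<phi> \<in> Form L s \<Longrightarrow> prop_theorem \<phi> \<Longrightarrow> K L s \<phi>"
| K_dist: "\<sigma> \<in> symbols L \<Longrightarrow> i < length (arity L \<sigma>) \<Longrightarrow> \<psi>s \<in> Args L \<sigma> \<Longrightarrow>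
     \<phi> \<in> Form L (arity L \<sigma> ! i) \<Longrightarrow> \<chi> \<in> Form L (arity L \<sigma> ! i) \<Longrightarrow>
     K L (target L \<sigma>)
       (Imp (Box \<sigma> (\<psi>s[i := Imp \<phi> \<chi>])) (Imp (Box \<sigma> (\<psi>s[i := \<phi>])) (Box \<sigma> (\<psi>s[i := \<chi>]))))"
| K_dual: "\<sigma> \<in> symbols L \<Longrightarrow> arity L \<sigma> \<noteq> [] \<Longrightarrow> \<psi>s \<in> Args L \<sigma> \<Longrightarrow>
     K L (target L \<sigma>) (Iff (App \<sigma> \<psi>s) (Neg (Box \<sigma> (map Neg \<psi>s))))"

primrec subst :: "('p \<Rightarrow> ('o, 'p) fm) \<Rightarrow> ('o, 'p) fm \<Rightarrow> ('o, 'p) fm" where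
  "subst f (Var p) = f p"
| "subst f (Neg \<phi>) = Neg (subst f \<phi>)"
| "subst f (Or \<phi> \<psi>) = Or (subst f \<phi>) (subst f \<psi>)"
| "subst f (App \<sigma> \<phi>s) = App \<sigma> (map (subst f) \<phi>s)"

definition sort_preserving :: "('s, 'o, 'p) language \<Rightarrow> ('p \<Rightarrow> ('o, 'p) fm) \<Rightarrow> bool" where
  "sort_preserving L f \<longleftrightarrow> (\<forall>s. \<forall>p \<in> pvars L s. f p \<in> Form L s)"

definition sorted_set :: "('s, 'o, 'p) language \<Rightarrow> ('s \<Rightarrow> ('o, 'p) fm set) \<Rightarrow> bool" where
  "sorted_set L \<Gamma> \<longleftrightarrow> (\<forall>s. \<Gamma> s \<subseteq> Form L s)"

definition Axioms ::
  "('s, 'o, 'p) language \<Rightarrow> ('s \<Rightarrow> ('o, 'p) fm set) \<Rightarrow> 's \<Rightarrow> ('o, 'p) fm set" where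
  "Axioms L \<Lambda> s = {\<phi>. K L s \<phi>} \<union> {subst f \<phi> | f \<phi>. sort_preserving L f \<and> \<phi> \<in> \<Lambda> s}"

text \<open>\<open>D\<close> is the set of earlier entries of the derivation, each paired with its sort.\<close>

definition MP :: "('s \<times> ('o, 'p) fm) set \<Rightarrow> 's \<Rightarrow> ('o, 'p) fm \<Rightarrow> bool" where
  "MP D s \<chi> \<longleftrightarrow> (\<exists>\<phi>. (s, \<phi>) \<in> D \<and> (s, Imp \<phi> \<chi>) \<in> D)"

definition UG ::
  "('s, 'o, 'p) language \<Rightarrow> ('s \<times> ('o, 'p) fm) set \<Rightarrow> 's \<Rightarrow> ('o, 'p) fm \<Rightarrow> bool" where
  "UG L D s \<chi> \<longleftrightarrow>
     (\<exists>\<sigma> i \<psi>s \<phi>. \<sigma> \<in> symbols L \<and> target L \<sigma> = s \<and> i < length (arity L \<sigma>) \<and>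
        \<psi>s \<in> Args L \<sigma> \<and> (arity L \<sigma> ! i, \<phi>) \<in> D \<and> \<chi> = Box \<sigma> (\<psi>s[i := \<phi>]))"

definition derivation ::
  "('s, 'o, 'p) language \<Rightarrow> ('s \<Rightarrow> ('o, 'p) fm set) \<Rightarrow> ('s \<Rightarrow> ('o, 'p) fm set) \<Rightarrow>
   ('s \<times> ('o, 'p) fm) list \<Rightarrow> bool" where
  "derivation L \<Lambda> \<Gamma> ds \<longleftrightarrow>
     (\<forall>k < length ds. \<forall>s \<chi>. ds ! k = (s, \<chi>) \<longrightarrow>
        \<chi> \<in> Form L s \<and>
        (\<chi> \<in> Axioms L \<Lambda> s \<or> \<chi> \<in> \<Gamma> s \<or> MP (set (take k ds)) s \<chi> \<or> UG L (set (take k ds)) s \<chi>))"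

definition derives ::
  "('s, 'o, 'p) language \<Rightarrow> ('s \<Rightarrow> ('o, 'p) fm set) \<Rightarrow> ('s \<Rightarrow> ('o, 'p) fm set) \<Rightarrow>
   's \<Rightarrow> ('o, 'p) fm \<Rightarrow> bool" where
  "derives L \<Lambda> \<Gamma> s \<phi> \<longleftrightarrow> (\<exists>ds. ds \<noteq> [] \<and> derivation L \<Lambda> \<Gamma> ds \<and> last ds = (s, \<phi>))"

definition single :: "'s \<Rightarrow> ('o, 'p) fm \<Rightarrow> 's \<Rightarrow> ('o, 'p) fm set" where
  "single s \<phi> = (\<lambda>t. if t = s then {\<phi>} else {})"

primrec gen_step ::
  "('s, 'o, 'p) language \<Rightarrow> ('s \<Rightarrow> ('o, 'p) fm set) \<Rightarrow> nat \<Rightarrow> 's \<Rightarrow> ('o, 'p) fm set" where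
  "gen_step L \<Delta> 0 = \<Delta>"
| "gen_step L \<Delta> (Suc k) = (\<lambda>s. gen_step L \<Delta> k s \<union>
     {Box \<sigma> (\<psi>s[i := \<gamma>]) | \<sigma> i \<psi>s \<gamma>. \<sigma> \<in> symbols L \<and> target L \<sigma> = s \<and>
        i < length (arity L \<sigma>) \<and> \<psi>s \<in> Args L \<sigma> \<and> \<gamma> \<in> gen_step L \<Delta> k (arity L \<sigma> ! i)})"

definition gen ::
  "('s, 'o, 'p) language \<Rightarrow> ('s \<Rightarrow> ('o, 'p) fm set) \<Rightarrow> 's \<Rightarrow> ('o, 'p) fm set" where
  "gen L \<Delta> s = (\<Union>k. gen_step L \<Delta> k s)"

end

theory Submission
  imports Defs
begin

text \<open>
  The forward direction is an induction on the derivation. Entries may have a sort \<open>t \<noteq> s\<close> in which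
  \<open>gen L (single s \<phi>) t\<close> is empty, so the induction is about nested implications
  \<open>\<gamma>\<^sub>1 \<rightarrow> (\<gamma>\<^sub>2 \<rightarrow> \<dots> \<rightarrow> \<chi>)\<close> with a possibly empty list of premises, instead of conjunctions.
  Distributivity of the boxes pushes a generalization through the implications, replacing every premise
  by a boxed one, which again lies in the generated set. In the sort \<open>s\<close> the premise \<open>\<phi>\<close> itself makes
  the list nonempty at the end. Conversely, every generated formula follows from \<open>\<phi>\<close> by
  universal generalization.
\<close>

section \<open>Sorts of compound formulas\<close>

lemma Neg_in_Form_iff [simp]: "Neg \<phi> \<in> Form L s \<longleftrightarrow> \<phi> \<in> Form L s"
  unfolding Form_def by (auto intro: has_sort.intros elim: has_sort.cases)

lemma Or_in_Form_iff [simp]: "Or \<phi> \<psi> \<in> Form L s \<longleftrightarrow> \<phi> \<in> Form L s \<and> \<psi> \<in> Form L s"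
  unfolding Form_def by (auto intro: has_sort.intros elim: has_sort.cases)

lemma And_in_Form_iff [simp]: "And \<phi> \<psi> \<in> Form L s \<longleftrightarrow> \<phi> \<in> Form L s \<and> \<psi> \<in> Form L s"
  by (simp add: And_def)

lemma Imp_in_Form_iff [simp]: "Imp \<phi> \<psi> \<in> Form L s \<longleftrightarrow> \<phi> \<in> Form L s \<and> \<psi> \<in> Form L s"
  by (simp add: Imp_def)

lemma Args_list_update:
  "\<psi>s \<in> Args L \<sigma> \<Longrightarrow> \<phi> \<in> Form L (arity L \<sigma> ! i) \<Longrightarrow> \<psi>s[i := \<phi>] \<in> Args L \<sigma>"
  \<comment> \<open>For \<open>i\<close> out of range the update leaves \<open>\<psi>s\<close> as it
    is.\<close>
  by (cases "i < length \<psi>s") (auto simp: Args_def nth_list_update)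

lemma Box_in_Form:
  assumes "\<sigma> \<in> symbols L" "\<psi>s \<in> Args L \<sigma>"
  shows "Box \<sigma> \<psi>s \<in> Form L (target L \<sigma>)"
proof -
  have "list_all2 (has_sort L) (map Neg \<psi>s) (arity L \<sigma>)"
    using assms(2) by (auto simp: Args_def Form_def list_all2_conv_all_nth intro: has_sort.intros)
  then show ?thesis
    using assms(1) by (auto simp: Box_def Form_def intro: has_sort.intros)
qed

lemma foldr_Imp_in_Form_iff:
  "foldr Imp \<gamma>s \<chi> \<in> Form L s \<longleftrightarrow> set \<gamma>s \<subseteq> Form L s \<and> \<chi> \<in> Form L s"
  by (induction \<gamma>s) auto

lemma foldl_And_in_Form_iff:
  "foldl And \<phi> \<gamma>s \<in> Form L s \<longleftrightarrow> \<phi> \<in> Form L s \<and> set \<gamma>s \<subseteq> Form L s"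
  by (induction \<gamma>s arbitrary: \<phi>) auto

lemma BigAnd_in_Form_iff:
  "\<gamma>s \<noteq> [] \<Longrightarrow> BigAnd \<gamma>s \<in> Form L s \<longleftrightarrow> set \<gamma>s \<subseteq> Form L s"
  by (cases \<gamma>s) (auto simp: BigAnd_def foldl_And_in_Form_iff)

section \<open>Truth values of iterated implications and conjunctions\<close>

lemma truth_And [simp]: "truth v (And \<phi> \<psi>) \<longleftrightarrow> truth v \<phi> \<and> truth v \<psi>"
  by (simp add: And_def)

lemma truth_Imp [simp]: "truth v (Imp \<phi> \<psi>) \<longleftrightarrow> (truth v \<phi> \<longrightarrow> truth v \<psi>)"
  by (simp add: Imp_def)

lemma truth_foldr_Imp:
  "truth v (foldr Imp \<gamma>s \<chi>) \<longleftrightarrow> ((\<forall>\<gamma> \<in> set \<gamma>s. truth v \<gamma>) \<longrightarrow> truth v \<chi>)"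
  by (induction \<gamma>s) auto

lemma truth_foldl_And:
  "truth v (foldl And \<phi> \<gamma>s) \<longleftrightarrow> truth v \<phi> \<and> (\<forall>\<gamma> \<in> set \<gamma>s. truth v \<gamma>)"
  by (induction \<gamma>s arbitrary: \<phi>) auto

lemma truth_BigAnd:
  "\<gamma>s \<noteq> [] \<Longrightarrow> truth v (BigAnd \<gamma>s) \<longleftrightarrow> (\<forall>\<gamma> \<in> set \<gamma>s. truth v \<gamma>)"
  by (cases \<gamma>s) (auto simp: BigAnd_def truth_foldl_And)

section \<open>Derivations and the closure properties of derivability\<close>

lemma MP_mono: "MP D s \<chi> \<Longrightarrow> D \<subseteq> D' \<Longrightarrow> MP D' s \<chi>"
  unfolding MP_def by blast

lemma UG_mono: "UG L D s \<chi> \<Longrightarrow> D \<subseteq> D' \<Longrightarrow> UG L D' s \<chi>"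
  unfolding UG_def by blast

text \<open>The rules consult only the set of earlier entries, and placing \<open>ds\<close> in
  front of \<open>es\<close> can only enlarge that set. This lets the two premises of modus ponens
  share one derivation.\<close>

lemma derivation_append:
  assumes "derivation L \<Lambda> \<Gamma> ds" "derivation L \<Lambda> \<Gamma> es"
  shows "derivation L \<Lambda> \<Gamma> (ds @ es)"
  unfolding derivation_def
proof (intro allI impI)
  fix k s \<chi>
  assume k: "k < length (ds @ es)" and eq: "(ds @ es) ! k = (s, \<chi>)"
  let ?ok = "\<lambda>D. \<chi> \<in> Form L s \<and>
    (\<chi> \<in> Axioms L \<Lambda> s \<or> \<chi> \<in> \<Gamma> s \<or> MP D s \<chi> \<or> UG L D s \<chi>)"
  \<comment> \<open>\<open>D\<close> collects the entries that precede the current one in its own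
    derivation, \<open>ds\<close> or \<open>es\<close>; monotonicity of the rules then passes to the
    longer list.\<close>
  obtain D where "?ok D" "D \<subseteq> set (take k (ds @ es))"
  proof (cases "k < length ds")
    case True
    then show ?thesis
      using assms(1) eq that[of "set (take k ds)"] by (auto simp: derivation_def nth_append)
  next
    case False
    then have "k - length ds < length es" "es ! (k - length ds) = (s, \<chi>)"
      using k eq by (auto simp: nth_append)
    then show ?thesis
      using assms(2) that[of "set (take (k - length ds) es)"]
      unfolding derivation_def by auto
  qed
  then show "?ok (set (take k (ds @ es)))"
    using MP_mono UG_mono by metis
qed

lemma derivation_snoc:
  assumes "derivation L \<Lambda> \<Gamma> ds" "\<chi> \<in> Form L s"
    and "\<chi> \<in> Axioms L \<Lambda> s \<or> \<chi> \<in> \<Gamma> s \<or> MP (set ds) s \<chi> \<or> UG L (set ds) s \<chi>"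
  shows "derivation L \<Lambda> \<Gamma> (ds @ [(s, \<chi>)])"
  unfolding derivation_def
proof (intro allI impI)
  fix k t \<theta>
  assume k: "k < length (ds @ [(s, \<chi>)])" and eq: "(ds @ [(s, \<chi>)]) ! k = (t, \<theta>)"
  let ?D = "set (take k (ds @ [(s, \<chi>)]))"
  show "\<theta> \<in> Form L t \<and> (\<theta> \<in> Axioms L \<Lambda> t \<or> \<theta> \<in> \<Gamma> t \<or> MP ?D t \<theta> \<or> UG L ?D t \<theta>)"
  proof (cases "k < length ds")
    case True
    then have "?D = set (take k ds)" "ds ! k = (t, \<theta>)"
      using eq by (simp_all add: nth_append)
    then show ?thesis
      using assms(1) True unfolding derivation_def by metis
  next
    case False
    then have "?D = set ds" "t = s" "\<theta> = \<chi>"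
      using k eq by (simp_all add: nth_append)
    then show ?thesis
      using assms(2,3) by simp
  qed
qed

lemma derivesI:
  assumes "derivation L \<Lambda> \<Gamma> ds" "\<chi> \<in> Form L s"
    and "\<chi> \<in> Axioms L \<Lambda> s \<or> \<chi> \<in> \<Gamma> s \<or> MP (set ds) s \<chi> \<or> UG L (set ds) s \<chi>"
  shows "derives L \<Lambda> \<Gamma> s \<chi>"
  unfolding derives_def using derivation_snoc[OF assms] by (intro exI[of _ "ds @ [(s, \<chi>)]"]) simp

text \<open>Membership is weaker than being the last entry, but it survives
  \<open>derivation_append\<close> and is all that the rules ask of a premise.\<close>

lemma derives_derivation:
  assumes "derives L \<Lambda> \<Gamma> s \<chi>"
  obtains ds where "derivation L \<Lambda> \<Gamma> ds" "(s, \<chi>) \<in> set ds"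
proof -
  obtain ds where "ds \<noteq> []" "derivation L \<Lambda> \<Gamma> ds" "last ds = (s, \<chi>)"
    using assms unfolding derives_def by blast
  then show ?thesis
    using that last_in_set[of ds] by simp
qed

lemma derivation_Nil: "derivation L \<Lambda> \<Gamma> []"
  by (simp add: derivation_def)

lemma derives_axiom: "\<chi> \<in> Form L s \<Longrightarrow> \<chi> \<in> Axioms L \<Lambda> s \<Longrightarrow> derives L \<Lambda> \<Gamma> s \<chi>"
  by (rule derivesI[OF derivation_Nil]) simp_all

lemma derives_hyp: "\<chi> \<in> Form L s \<Longrightarrow> \<chi> \<in> \<Gamma> s \<Longrightarrow> derives L \<Lambda> \<Gamma> s \<chi>"
  by (rule derivesI[OF derivation_Nil]) simp_all

lemma derivation_in_Form:
  "derivation L \<Lambda> \<Gamma> ds \<Longrightarrow> (s, \<chi>) \<in> set ds \<Longrightarrow> \<chi> \<in> Form L s"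
  unfolding derivation_def by (metis in_set_conv_nth)

lemma derives_in_Form: "derives L \<Lambda> \<Gamma> s \<chi> \<Longrightarrow> \<chi> \<in> Form L s"
  by (meson derives_derivation derivation_in_Form)

lemma derives_MP:
  assumes "derives L \<Lambda> \<Gamma> s (Imp \<phi> \<chi>)" "derives L \<Lambda> \<Gamma> s \<phi>"
  shows "derives L \<Lambda> \<Gamma> s \<chi>"
proof -
  obtain ds es where "derivation L \<Lambda> \<Gamma> ds" "(s, Imp \<phi> \<chi>) \<in> set ds"
    and "derivation L \<Lambda> \<Gamma> es" "(s, \<phi>) \<in> set es"
    using assms derives_derivation by metis
  then have "derivation L \<Lambda> \<Gamma> (ds @ es)" "MP (set (ds @ es)) s \<chi>"
    by (auto simp: MP_def intro: derivation_append)
  then show ?thesis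
    using derivesI derives_in_Form[OF assms(1)] by (metis Imp_in_Form_iff)
qed

lemma derives_UG:
  assumes "derives L \<Lambda> \<Gamma> (arity L \<sigma> ! i) \<phi>"
    and "\<sigma> \<in> symbols L" "i < length (arity L \<sigma>)" "\<psi>s \<in> Args L \<sigma>"
  shows "derives L \<Lambda> \<Gamma> (target L \<sigma>) (Box \<sigma> (\<psi>s[i := \<phi>]))"
proof -
  obtain ds where ds: "derivation L \<Lambda> \<Gamma> ds" "(arity L \<sigma> ! i, \<phi>) \<in> set ds"
    using assms(1) derives_derivation by metis
  then have "UG L (set ds) (target L \<sigma>) (Box \<sigma> (\<psi>s[i := \<phi>]))"
    using assms(2-4) unfolding UG_def by blast
  moreover have "Box \<sigma> (\<psi>s[i := \<phi>]) \<in> Form L (target L \<sigma>)"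
    using assms(2-4) derives_in_Form[OF assms(1)] by (intro Box_in_Form Args_list_update)
  ultimately show ?thesis
    using ds(1) derivesI by metis
qed

text \<open>This turns derivation sequences into rule induction, so that list indices do not appear
  in later proofs. \<open>P\<close> ranges over all sorts because generalization changes the sort.
  The \<open>UG\<close> case also supplies the sort of the premise, which
  \<open>Box_foldr_Imp\<close> requires.\<close>

lemma derives_induct [consumes 1, case_names axiom hyp MP UG]:
  assumes "derives L \<Lambda> \<Gamma> s \<chi>"
    and axiom: "\<And>s \<chi>. \<chi> \<in> Form L s \<Longrightarrow> \<chi> \<in> Axioms L \<Lambda> s \<Longrightarrow> P s \<chi>"
    and hyp: "\<And>s \<chi>. \<chi> \<in> Form L s \<Longrightarrow> \<chi> \<in> \<Gamma> s \<Longrightarrow> P s \<chi>"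
    and MP: "\<And>s \<phi> \<chi>. \<chi> \<in> Form L s \<Longrightarrow> P s \<phi> \<Longrightarrow> P s (Imp \<phi> \<chi>) \<Longrightarrow> P s \<chi>"
    and UG: "\<And>\<sigma> i \<psi>s \<phi>. \<sigma> \<in> symbols L \<Longrightarrow> i < length (arity L \<sigma>) \<Longrightarrow> \<psi>s \<in> Args L \<sigma> \<Longrightarrow>
      \<phi> \<in> Form L (arity L \<sigma> ! i) \<Longrightarrow> P (arity L \<sigma> ! i) \<phi> \<Longrightarrow>
      P (target L \<sigma>) (Box \<sigma> (\<psi>s[i := \<phi>]))"
  shows "P s \<chi>"
proof -
  obtain ds where ds: "derivation L \<Lambda> \<Gamma> ds" "(s, \<chi>) \<in> set ds"
    using assms(1) derives_derivation by metis
  have "ds ! k = (t, \<theta>) \<Longrightarrow> P t \<theta>" if "k < length ds" for k t \<theta>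
    using that
  \<comment> \<open>Strong induction is used because a premise may occur at any smaller
    position.\<close>
  proof (induction k arbitrary: t \<theta> rule: less_induct)
    case (less k)
    have earlier: "P u \<xi> \<and> \<xi> \<in> Form L u" if "(u, \<xi>) \<in> set (take k ds)" for u \<xi>
    proof -
      obtain j where "j < k" "ds ! j = (u, \<xi>)"
        using \<open>k < length ds\<close> \<open>(u, \<xi>) \<in> set (take k ds)\<close> by (auto simp: in_set_conv_nth)
      then show ?thesis
        using less derivation_in_Form[OF ds(1)] by (metis less_trans nth_mem)
    qed
    have form: "\<theta> \<in> Form L t"
      and "\<theta> \<in> Axioms L \<Lambda> t \<or> \<theta> \<in> \<Gamma> t \<or> MP (set (take k ds)) t \<theta> \<or> UG L (set (take k ds)) t \<theta>"
      using ds(1) less.prems unfolding derivation_def by blast+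
    then consider "\<theta> \<in> Axioms L \<Lambda> t" | "\<theta> \<in> \<Gamma> t" | "MP (set (take k ds)) t \<theta>"
      | "UG L (set (take k ds)) t \<theta>"
      by blast
    then show ?case
    proof cases
      case 3
      then show ?thesis
        using MP[OF form] earlier unfolding MP_def by blast
    next
      case 4
      then show ?thesis
        using UG earlier unfolding UG_def by blast
    qed (use form axiom hyp in blast)+
  qed
  then show ?thesis
    using ds(2) by (metis in_set_conv_nth)
qed

lemma derives_mono:
  assumes "derives L \<Lambda> \<Gamma> s \<chi>" "\<And>t. \<Gamma> t \<subseteq> \<Gamma>' t"
  shows "derives L \<Lambda> \<Gamma>' s \<chi>"
  using assms(1)
proof (induction rule: derives_induct)
  case (hyp s \<chi>)
  then show ?case
    using assms(2) by (blast intro: derives_hyp)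
next
  case (MP s \<phi> \<chi>)
  then show ?case
    using derives_MP by metis
qed (auto intro: derives_axiom derives_UG)

section \<open>Propositional reasoning and distribution of boxes\<close>

lemma derives_prop: "\<chi> \<in> Form L s \<Longrightarrow> (\<And>v. truth v \<chi>) \<Longrightarrow> derives L \<Lambda> \<Gamma> s \<chi>"
  by (rule derives_axiom) (auto simp: Axioms_def prop_theorem_def intro: K_prop)

text \<open>The implication from \<open>\<phi>\<close> to \<open>\<chi>\<close> is a tautology and
  hence an axiom, so one modus ponens suffices. Propositional steps thereby reduce to comparing
  truth values.\<close>

lemma derives_consequence:
  assumes "derives L \<Lambda> \<Gamma> s \<phi>" "\<chi> \<in> Form L s" "\<And>v. truth v \<phi> \<Longrightarrow> truth v \<chi>"
  shows "derives L \<Lambda> \<Gamma> s \<chi>"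
proof -
  have "derives L \<Lambda> \<Gamma> s (Imp \<phi> \<chi>)"
    using assms derives_in_Form by (intro derives_prop) auto
  then show ?thesis
    using assms(1) by (rule derives_MP)
qed

lemma derives_consequence2:
  assumes "derives L \<Lambda> \<Gamma> s \<phi>" "derives L \<Lambda> \<Gamma> s \<theta>" "\<chi> \<in> Form L s"
    and "\<And>v. truth v \<phi> \<Longrightarrow> truth v \<theta> \<Longrightarrow> truth v \<chi>"
  shows "derives L \<Lambda> \<Gamma> s \<chi>"
proof -
  have "derives L \<Lambda> \<Gamma> s (Imp \<theta> \<chi>)"
    using assms derives_in_Form by (intro derives_consequence[OF assms(1)]) auto
  then show ?thesis
    using assms(2) by (rule derives_MP)
qed

lemma derives_foldr_MP:
  "derives L \<Lambda> \<Gamma> s (foldr Imp \<gamma>s \<chi>) \<Longrightarrow> (\<And>\<gamma>. \<gamma> \<in> set \<gamma>s \<Longrightarrow> derives L \<Lambda> \<Gamma> s \<gamma>) \<Longrightarrow>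
    derives L \<Lambda> \<Gamma> s \<chi>"
proof (induction \<gamma>s)
  case (Cons \<gamma> \<gamma>s)
  then have "derives L \<Lambda> \<Gamma> s (foldr Imp \<gamma>s \<chi>)"
    using derives_MP[of L \<Lambda> \<Gamma> s \<gamma> "foldr Imp \<gamma>s \<chi>"] by simp
  then show ?case
    using Cons by simp
qed simp

text \<open>Each application of \<open>K_dist\<close> moves the box past the outermost implication;
  induction on \<open>\<gamma>s\<close> treats the remaining ones.\<close>

lemma Box_foldr_Imp:
  assumes "\<sigma> \<in> symbols L" "i < length (arity L \<sigma>)" "\<psi>s \<in> Args L \<sigma>"
    and "set \<gamma>s \<subseteq> Form L (arity L \<sigma> ! i)" "\<chi> \<in> Form L (arity L \<sigma> ! i)"
  shows "derives L \<Lambda> \<Gamma> (target L \<sigma>) (Imp (Box \<sigma> (\<psi>s[i := foldr Imp \<gamma>s \<chi>]))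
    (foldr Imp (map (\<lambda>\<gamma>. Box \<sigma> (\<psi>s[i := \<gamma>])) \<gamma>s) (Box \<sigma> (\<psi>s[i := \<chi>]))))"
  using assms(4)
proof (induction \<gamma>s)
  case Nil
  then show ?case
    using assms by (auto intro!: derives_prop Box_in_Form Args_list_update)
next
  case (Cons \<gamma> \<gamma>s)
  let ?\<theta> = "foldr Imp \<gamma>s \<chi>"
  have forms: "\<gamma> \<in> Form L (arity L \<sigma> ! i)" "?\<theta> \<in> Form L (arity L \<sigma> ! i)"
    using Cons.prems assms(5) by (auto simp: foldr_Imp_in_Form_iff)
  have box: "Box \<sigma> (\<psi>s[i := \<xi>]) \<in> Form L (target L \<sigma>)" if "\<xi> \<in> Form L (arity L \<sigma> ! i)" for \<xi>
    using that assms(1,3) by (auto intro: Box_in_Form Args_list_update)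
  have dist: "derives L \<Lambda> \<Gamma> (target L \<sigma>) (Imp (Box \<sigma> (\<psi>s[i := Imp \<gamma> ?\<theta>]))
      (Imp (Box \<sigma> (\<psi>s[i := \<gamma>])) (Box \<sigma> (\<psi>s[i := ?\<theta>]))))"
    by (rule derives_axiom)
      (use forms box assms in \<open>auto simp: Axioms_def intro: K_dist\<close>)
  have IH: "derives L \<Lambda> \<Gamma> (target L \<sigma>) (Imp (Box \<sigma> (\<psi>s[i := ?\<theta>]))
      (foldr Imp (map (\<lambda>\<gamma>. Box \<sigma> (\<psi>s[i := \<gamma>])) \<gamma>s) (Box \<sigma> (\<psi>s[i := \<chi>]))))"
    using Cons by simp
  show ?case
    \<comment> \<open>For \<open>truth\<close> a box is a negated atom, so this is chaining of two
      implications below the premise \<open>Box \<sigma> (\<psi>s[i := \<gamma>])\<close>.\<close>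
    by (rule derives_consequence2[OF dist IH]) (use box forms derives_in_Form[OF IH] in auto)
qed

section \<open>Generated sets and the deduction theorem\<close>

lemma gen_base: "\<gamma> \<in> \<Delta> s \<Longrightarrow> \<gamma> \<in> gen L \<Delta> s"
  unfolding gen_def by (rule UN_I[of 0]) simp_all

lemma gen_Box:
  assumes "\<gamma> \<in> gen L \<Delta> (arity L \<sigma> ! i)"
    and "\<sigma> \<in> symbols L" "i < length (arity L \<sigma>)" "\<psi>s \<in> Args L \<sigma>"
  shows "Box \<sigma> (\<psi>s[i := \<gamma>]) \<in> gen L \<Delta> (target L \<sigma>)"
proof -
  obtain k where "\<gamma> \<in> gen_step L \<Delta> k (arity L \<sigma> ! i)"
    using assms(1) by (auto simp: gen_def)
  then have "Box \<sigma> (\<psi>s[i := \<gamma>]) \<in> gen_step L \<Delta> (Suc k) (target L \<sigma>)"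
    using assms(2-4) by auto
  then show ?thesis
    unfolding gen_def by blast
qed

lemma gen_derives:
  assumes "sorted_set L \<Delta>" "\<gamma> \<in> gen L \<Delta> s"
  shows "derives L \<Lambda> \<Delta> s \<gamma>"
proof -
  have "\<gamma> \<in> gen_step L \<Delta> k s \<Longrightarrow> derives L \<Lambda> \<Delta> s \<gamma>" for k
  \<comment> \<open>The sort must vary: a box of sort \<open>target L \<sigma>\<close> arises from a
    formula of sort \<open>arity L \<sigma> ! i\<close>.\<close>
  proof (induction k arbitrary: s \<gamma>)
    case 0
    then show ?case
      using assms(1) by (auto simp: sorted_set_def intro: derives_hyp)
  next
    case (Suc k)
    then show ?case
      by (auto intro: derives_UG)
  qed
  then show ?thesis
    using assms(2) by (auto simp: gen_def)
qed

text \<open>Derivable formulas are well sorted, so a second induction over the stages is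
  avoided.\<close>

lemma gen_in_Form: "sorted_set L \<Delta> \<Longrightarrow> gen L \<Delta> s \<subseteq> Form L s"
  by (meson derives_in_Form gen_derives subsetI)

text \<open>A deduction theorem for global consequence. Generalizing an implication with premise
  \<open>\<gamma>\<close> leads to a boxed \<open>\<gamma>\<close>, so the premises have to come
  from the closure of \<open>\<Delta>\<close> under boxes rather than from \<open>\<Delta>\<close>
  itself.\<close>

lemma derives_Un_imp:
  assumes "derives L \<Lambda> (\<lambda>t. \<Gamma> t \<union> \<Delta> t) s \<chi>" "sorted_set L \<Delta>"
  shows "\<exists>\<gamma>s. set \<gamma>s \<subseteq> gen L \<Delta> s \<and> derives L \<Lambda> \<Gamma> s (foldr Imp \<gamma>s \<chi>)"
  using assms(1)
proof (induction rule: derives_induct)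
  case (axiom s \<chi>)
  then have "set [] \<subseteq> gen L \<Delta> s" "derives L \<Lambda> \<Gamma> s (foldr Imp [] \<chi>)"
    by (auto intro: derives_axiom)
  then show ?case
    by blast
next
  case (hyp s \<chi>)
  show ?case
  proof (cases "\<chi> \<in> \<Gamma> s")
    case True
    then have "set [] \<subseteq> gen L \<Delta> s" "derives L \<Lambda> \<Gamma> s (foldr Imp [] \<chi>)"
      using hyp by (auto intro: derives_hyp)
    then show ?thesis
      by blast
  next
    case False
    then have "set [\<chi>] \<subseteq> gen L \<Delta> s" "derives L \<Lambda> \<Gamma> s (foldr Imp [\<chi>] \<chi>)"
      using hyp by (auto intro: gen_base derives_prop)
    then show ?thesis
      by blast
  qed
next
  case (MP s \<phi> \<chi>)
  then obtain \<gamma>s \<delta>s where sub: "set \<gamma>s \<subseteq> gen L \<Delta> s" "set \<delta>s \<subseteq> gen L \<Delta> s"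
    and der: "derives L \<Lambda> \<Gamma> s (foldr Imp \<gamma>s \<phi>)" "derives L \<Lambda> \<Gamma> s (foldr Imp \<delta>s (Imp \<phi> \<chi>))"
    by blast
  \<comment> \<open>Both premise lists are kept, one after the other. \<open>foldr_append\<close> is
    disabled so that the rules about \<open>foldr Imp\<close> apply to the whole list at
    once.\<close>
  have "foldr Imp (\<gamma>s @ \<delta>s) \<chi> \<in> Form L s"
    using sub gen_in_Form[OF assms(2)] MP(1) by (auto simp del: foldr_append simp: foldr_Imp_in_Form_iff)
  with der have "derives L \<Lambda> \<Gamma> s (foldr Imp (\<gamma>s @ \<delta>s) \<chi>)"
    by (rule derives_consequence2) (auto simp del: foldr_append simp: truth_foldr_Imp)
  moreover have "set (\<gamma>s @ \<delta>s) \<subseteq> gen L \<Delta> s"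
    using sub by simp
  ultimately show ?case
    by blast
next
  case (UG \<sigma> i \<psi>s \<phi>)
  then obtain \<gamma>s where sub: "set \<gamma>s \<subseteq> gen L \<Delta> (arity L \<sigma> ! i)"
    and der: "derives L \<Lambda> \<Gamma> (arity L \<sigma> ! i) (foldr Imp \<gamma>s \<phi>)"
    by blast
  let ?\<delta>s = "map (\<lambda>\<gamma>. Box \<sigma> (\<psi>s[i := \<gamma>])) \<gamma>s"
  have "set \<gamma>s \<subseteq> Form L (arity L \<sigma> ! i)"
    using sub gen_in_Form[OF assms(2)] by blast
  \<comment> \<open>The whole nested implication is generalized first; \<open>Box_foldr_Imp\<close>
    then distributes the box over its premises.\<close>
  then have "derives L \<Lambda> \<Gamma> (target L \<sigma>) (foldr Imp ?\<delta>s (Box \<sigma> (\<psi>s[i := \<phi>])))"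
    using UG(1-4) by (intro derives_MP[OF Box_foldr_Imp] derives_UG[OF der])
  moreover have "set ?\<delta>s \<subseteq> gen L \<Delta> (target L \<sigma>)"
    using sub UG(1-3) by (auto intro: gen_Box)
  ultimately show ?case
    by blast
qed

theorem mainTheorem5:
  fixes L :: "('s, 'o, 'p) language"
    and \<Lambda> \<Gamma> :: "'s \<Rightarrow> ('o, 'p) fm set"
    and s :: 's
    and \<phi> \<psi> :: "('o, 'p) fm"
  assumes "is_language L"
    and "sorted_set L \<Lambda>"
    and "sorted_set L \<Gamma>"
    and "\<phi> \<in> Form L s"
    and "\<psi> \<in> Form L s"
  shows "derives L \<Lambda> (\<lambda>t. \<Gamma> t \<union> single s \<phi> t) s \<psi> \<longleftrightarrow>
    (\<exists>\<phi>s. \<phi>s \<noteq> [] \<and> set \<phi>s \<subseteq> gen L (single s \<phi>) s \<and>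
       derives L \<Lambda> \<Gamma> s (Imp (BigAnd \<phi>s) \<psi>))"
proof -
  let ?\<Delta> = "single s \<phi>"
  have sorted: "sorted_set L ?\<Delta>"
    using assms(4) by (simp add: sorted_set_def single_def)
  show ?thesis
  proof
    assume "derives L \<Lambda> (\<lambda>t. \<Gamma> t \<union> ?\<Delta> t) s \<psi>"
    from derives_Un_imp[OF this sorted] obtain \<gamma>s where sub: "set \<gamma>s \<subseteq> gen L ?\<Delta> s"
      and der: "derives L \<Lambda> \<Gamma> s (foldr Imp \<gamma>s \<psi>)"
      by blast
    \<comment> \<open>\<open>BigAnd []\<close> is the unspecified \<open>hd []\<close>, so
      \<open>\<gamma>s\<close> cannot be used if it is empty. Adding the conjunct
      \<open>\<phi>\<close> only strengthens the antecedent.\<close>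
    have sub': "set (\<phi> # \<gamma>s) \<subseteq> gen L ?\<Delta> s"
      using sub by (auto simp: single_def intro: gen_base)
    have "Imp (BigAnd (\<phi> # \<gamma>s)) \<psi> \<in> Form L s"
      using sub' gen_in_Form[OF sorted] assms(5) by (auto simp: BigAnd_in_Form_iff)
    with der have "derives L \<Lambda> \<Gamma> s (Imp (BigAnd (\<phi> # \<gamma>s)) \<psi>)"
      by (rule derives_consequence) (simp add: truth_foldr_Imp truth_BigAnd)
    with sub' show "\<exists>\<phi>s. \<phi>s \<noteq> [] \<and> set \<phi>s \<subseteq> gen L ?\<Delta> s \<and>
        derives L \<Lambda> \<Gamma> s (Imp (BigAnd \<phi>s) \<psi>)"
      by (intro exI[of _ "\<phi> # \<gamma>s"]) simp
  next
    assume "\<exists>\<phi>s. \<phi>s \<noteq> [] \<and> set \<phi>s \<subseteq> gen L ?\<Delta> s \<and> derives L \<Lambda> \<Gamma> s (Imp (BigAnd \<phi>s) \<psi>)"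
    then obtain \<phi>s where ne: "\<phi>s \<noteq> []" and sub: "set \<phi>s \<subseteq> gen L ?\<Delta> s"
      and der: "derives L \<Lambda> \<Gamma> s (Imp (BigAnd \<phi>s) \<psi>)"
      by blast
    \<comment> \<open>The conjunction is curried so that its conjuncts can be discharged one by one
      with \<open>derives_foldr_MP\<close>.\<close>
    have "foldr Imp \<phi>s \<psi> \<in> Form L s"
      using sub gen_in_Form[OF sorted] assms(5) by (auto simp: foldr_Imp_in_Form_iff)
    with der have "derives L \<Lambda> \<Gamma> s (foldr Imp \<phi>s \<psi>)"
      by (rule derives_consequence) (simp add: truth_foldr_Imp truth_BigAnd ne)
    then have "derives L \<Lambda> (\<lambda>t. \<Gamma> t \<union> ?\<Delta> t) s (foldr Imp \<phi>s \<psi>)"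
      by (rule derives_mono) simp
    moreover have "derives L \<Lambda> (\<lambda>t. \<Gamma> t \<union> ?\<Delta> t) s \<gamma>" if "\<gamma> \<in> set \<phi>s" for \<gamma>
    proof -
      have "derives L \<Lambda> ?\<Delta> s \<gamma>"
        using that sub by (auto intro: gen_derives[OF sorted])
      then show ?thesis
        by (rule derives_mono) simp
    qed
    ultimately show "derives L \<Lambda> (\<lambda>t. \<Gamma> t \<union> ?\<Delta> t) s \<psi>"
      by (rule derives_foldr_MP)
  qed
qed

end
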